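(* Let $a,q$ be integers with $1\leq a<q$ and $\gcd(a,q)=1$. Then \[ S(a/q)-S(-q/a)=\sqrt{q/a}+E_{+}(a,q),\qquad S(-a/q)-S(q/a)=E_{-}(a,q), \] where the error terms satisfy $|E_{\pm}(a,q)|\leq \tfrac32 k_{a/q}+3$, with $k_{a/q}$ the number of steps in the Euclidean division algorithm applied to $q/a$ (in particular $E_{\pm}(a,q)=O(\log(2+q))$).
   Context: For a rational number $x$, write $x=a/q$ in lowest terms with $a,q\in\mathbb{Z}$, $q>0$, $\gcd(a,q)=1$, and define \[ S(x)=S(a/q):=\#\{(m,n)\in\mathbb{Z}^2:\ m>0,\ n>0,\ mn<q,\ am\equiv n \pmod q\}. \] (This is a $1$-periodic function on $\mathbb{Q}$.) *)

theory Defs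
  imports Complex_Main "HOL-Number_Theory.Cong"
begin

text \<open>
  \<open>quotient_of x\<close> is the representation of \<open>x\<close> in lowest terms with positive
  denominator. The set counted below is finite, since \<open>m, n > 0\<close> and
  \<open>m * n < q\<close> force \<open>m, n < q\<close>; so \<open>card\<close> is a genuine count.
\<close>

definition S :: "rat \<Rightarrow> nat" where
  "S x = (let (a, q) = quotient_of x in
     card {(m :: int, n :: int). m > 0 \<and> n > 0 \<and> m * n < q \<and> [a * m = n] (mod q)})"

text \<open>
  Number of divisions with remainder carried out by Euclid's algorithm started on
  \<open>(b, c)\<close>, up to and including the one with remainder \<open>0\<close>. For
  \<open>b > c > 0\<close> this is the number of partial quotients of \<open>b / c\<close>. The clause for
  \<open>c < 0\<close> is never reached from \<open>c \<ge> 0\<close>.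
\<close>

function euclid_steps :: "int \<Rightarrow> int \<Rightarrow> nat" where
  "euclid_steps b c = (if c \<le> 0 then 0 else Suc (euclid_steps c (b mod c)))"
  by pat_completeness auto
termination
  by (relation "measure (\<lambda>(b, c). nat c)") auto

declare euclid_steps.simps [simp del]

end

theory Submission
  imports Defs
begin

text \<open>
  Writing \<open>n = a * m - q * l\<close>, the number \<open>S (a/q)\<close> counts the pairs \<open>(m, l)\<close> with
  \<open>0 < a/q - l/m < 1/m\<^sup>2\<close>, and \<open>S (-a/q)\<close> those with \<open>0 < l/m - a/q < 1/m\<^sup>2\<close>.
  Exchanging \<open>m\<close> and \<open>l\<close> embeds the approximations of \<open>c/b\<close> from below with \<open>m > 0\<close> into the
  approximations of \<open>b/c\<close> from above; those with \<open>m = 0\<close> give the term \<open>sqrt (q/a)\<close>.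
  The points outside the image of the embedding lie on distinct rays through the origin, so they
  are at most as many as the primitive approximations from above. By the argument behind Fatou's
  theorem, such an approximation is a convergent or an intermediate fraction adjacent to one,
  so every second division of Euclid's algorithm contributes at most three of them.
\<close>

section \<open>Products of coordinates in lattice cones\<close>

text \<open>The cross term \<open>\<alpha> * \<beta> * (m' * v)\<close> suffices: it is at least
  \<open>m' * v\<close>, which equals \<open>c + m * v'\<close>, and the other terms of the
  expansion are nonnegative.\<close>

lemma cone_product_ge:
  fixes m v m' v' \<alpha> \<beta> c :: int
  assumes "0 \<le> m" "0 \<le> v" "0 \<le> m'" "0 \<le> v'" "m' * v - m * v' = c" "1 \<le> \<alpha>" "1 \<le> \<beta>"
  shows "c \<le> (\<alpha> * m + \<beta> * m') * (\<alpha> * v + \<beta> * v')"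
proof -
  have "1 * 1 \<le> \<alpha> * \<beta>"
    using assms by (intro mult_mono) auto
  then have "1 * (m' * v) \<le> (\<alpha> * \<beta>) * (m' * v)"
    using assms by (intro mult_right_mono) auto
  moreover have "0 \<le> \<alpha> * m * (\<alpha> * v)" "0 \<le> \<beta> * m' * (\<beta> * v')" "0 \<le> \<alpha> * m * (\<beta> * v')" "0 \<le> m * v'"
    using assms by auto
  ultimately show ?thesis
    using assms(5) by (simp add: algebra_simps)
qed

text \<open>Write X and Y for the two factors. Then X * r + p * Y = c, hence (X - p) * (Y - r) = X *
  Y - c + p * r. Distance at least 2 of \<open>i\<close> from both 0 and \<open>j\<close> gives X >=
  2 * p and Y >= 2 * r, so the left side is at least p * r.\<close>

lemma edge_product_ge:
  fixes m v p r c i j :: int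
  assumes "0 \<le> m" "0 \<le> p" "0 \<le> r" "m * r + p * v = c" "j * r \<le> v" "2 \<le> i" "i \<le> j - 2"
  shows "c \<le> (m + i * p) * (v - i * r)"
proof -
  have "1 * p \<le> (i - 1) * p"
    using assms by (intro mult_right_mono) auto
  then have 1: "p \<le> m + i * p - p"
    using assms by (simp add: algebra_simps)
  have "2 * r \<le> (j - i) * r"
    using assms by (intro mult_right_mono) auto
  then have 2: "r \<le> v - i * r - r"
    using assms by (simp add: algebra_simps)
  have "p * r \<le> (m + i * p - p) * (v - i * r - r)"
    using 1 2 assms by (intro mult_mono) auto
  then show ?thesis
    using assms(4) by (simp add: algebra_simps)
qed

section \<open>Primitive points under a hyperbola along Euclid's algorithm\<close>

text \<open>
  The coordinates \<open>(\<alpha>, \<beta>)\<close> refer to a basis \<open>(m, v)\<close>, \<open>(p, -r)\<close> of a planar lattice of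
  determinant \<open>c = m * r + p * v\<close>; counted are primitive points \<open>(x, y)\<close> with \<open>y > 0\<close>, \<open>x * y < c\<close>.
  The two shears below are the divisions of Euclid's algorithm on \<open>(v, r)\<close>.
\<close>

definition prim_points :: "int \<Rightarrow> int \<Rightarrow> int \<Rightarrow> int \<Rightarrow> int \<Rightarrow> (int \<times> int) set" where
  "prim_points c m v p r = {(\<alpha>, \<beta>). 1 \<le> \<alpha> \<and> 1 \<le> \<beta> \<and> coprime \<alpha> \<beta> \<and>
     0 < \<alpha> * v - \<beta> * r \<and> (\<alpha> * m + \<beta> * p) * (\<alpha> * v - \<beta> * r) < c}"

lemma prim_points_zero_left: "0 \<le> r \<Longrightarrow> prim_points c m 0 p r = {}"
  by (auto simp: prim_points_def) (smt (verit) mult_nonneg_nonneg)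

text \<open>When the algorithm ends, both basis vectors lie in the closed quadrant, so
  \<open>cone_product_ge\<close> excludes the whole open cone.\<close>

lemma prim_points_zero_right:
  assumes "0 \<le> m" "0 \<le> v" "0 \<le> p" "p * v = c"
  shows "prim_points c m v p 0 = {}"
  using cone_product_ge[of m v p 0 c] assms by (force simp: prim_points_def)

text \<open>With e = (m, v) and f = (p, -r), this replaces f by f + j * e. No point is lost, since
  \<open>\<alpha> * v > \<beta> * r\<close> and \<open>r \<ge> j * v\<close> force
  \<open>\<alpha> > j * \<beta>\<close>. A division of this kind therefore costs nothing.\<close>

lemma prim_points_shear_lower:
  assumes "0 \<le> j" "j * v \<le> r" "0 \<le> v"
  shows "prim_points c m v p r
       = (\<lambda>(\<alpha>, \<beta>). (\<alpha> + j * \<beta>, \<beta>)) ` prim_points c m v (p + j * m) (r - j * v)"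
    (is "?A = ?f ` ?B")
proof (intro equalityI subsetI)
  fix z assume "z \<in> ?A"
  then obtain \<alpha> \<beta> where z: "z = (\<alpha>, \<beta>)" "1 \<le> \<alpha>" "1 \<le> \<beta>" "coprime \<alpha> \<beta>" "0 < \<alpha> * v - \<beta> * r"
      "(\<alpha> * m + \<beta> * p) * (\<alpha> * v - \<beta> * r) < c"
    by (auto simp: prim_points_def)
  have "\<beta> * (j * v) \<le> \<beta> * r"
    using z assms by (intro mult_left_mono) auto
  moreover have "(\<alpha> - j * \<beta>) * v = \<alpha> * v - \<beta> * (j * v)"
    by (simp add: algebra_simps)
  ultimately have "0 < (\<alpha> - j * \<beta>) * v"
    using z(5) by linarith
  then have "1 \<le> \<alpha> - j * \<beta>"
    using assms by (auto simp: zero_less_mult_iff)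
  moreover have "coprime (\<alpha> - j * \<beta>) \<beta>"
    using z(4) by (metis add.commute coprime_iff_gcd_eq_1 diff_add_cancel gcd_add_mult gcd.commute)
  ultimately have "(\<alpha> - j * \<beta>, \<beta>) \<in> ?B"
    using z by (simp add: prim_points_def algebra_simps)
  moreover have "z = ?f (\<alpha> - j * \<beta>, \<beta>)"
    using z by simp
  ultimately show "z \<in> ?f ` ?B" by blast
next
  fix z assume "z \<in> ?f ` ?B"
  then obtain \<alpha> \<beta> where z: "z = (\<alpha> + j * \<beta>, \<beta>)" "1 \<le> \<alpha>" "1 \<le> \<beta>" "coprime \<alpha> \<beta>"
      "0 < \<alpha> * v - \<beta> * (r - j * v)"
      "(\<alpha> * m + \<beta> * (p + j * m)) * (\<alpha> * v - \<beta> * (r - j * v)) < c"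
    by (auto simp: prim_points_def)
  have "coprime (\<alpha> + j * \<beta>) \<beta>"
    using z(4) by (metis add.commute coprime_iff_gcd_eq_1 gcd_add_mult gcd.commute)
  moreover have "1 \<le> \<alpha> + j * \<beta>"
    using z assms by (smt (verit) mult_nonneg_nonneg)
  ultimately show "z \<in> ?A"
    using z by (simp add: prim_points_def algebra_simps)
qed

text \<open>
  With \<open>e = (m, v)\<close> and \<open>f = (p, -r)\<close>, the points not coming from the sheared basis lie in the cones
  spanned by \<open>e + i * f\<close> and \<open>e + (i + 1) * f\<close>, \<open>i < j\<close>. The interiors of these cones miss the
  region, and so do the \<open>e + i * f\<close> at distance at least 2 from both ends.
\<close>

lemma prim_points_shear_upper:
  assumes "0 \<le> m" "0 \<le> p" "0 \<le> r" "m * r + p * v = c" "0 \<le> j" "j * r \<le> v"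
  shows "prim_points c m v p r
       \<subseteq> {(1, 1), (1, j - 1), (1, j)}
         \<union> (\<lambda>(\<alpha>, \<beta>). (\<alpha>, \<beta> + j * \<alpha>)) ` prim_points c (m + j * p) (v - j * r) p r"
    (is "?A \<subseteq> ?E \<union> ?f ` ?B")
proof
  fix z assume "z \<in> ?A"
  then obtain \<alpha> \<beta> where z: "z = (\<alpha>, \<beta>)" "1 \<le> \<alpha>" "1 \<le> \<beta>" "coprime \<alpha> \<beta>" "0 < \<alpha> * v - \<beta> * r"
      "(\<alpha> * m + \<beta> * p) * (\<alpha> * v - \<beta> * r) < c"
    by (auto simp: prim_points_def)
  show "z \<in> ?E \<union> ?f ` ?B"
  proof (cases "\<beta> \<le> j * \<alpha>")
    case False
    moreover have "coprime \<alpha> (\<beta> - j * \<alpha>)"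
      using z(4) by (metis add.commute coprime_iff_gcd_eq_1 diff_add_cancel gcd_add_mult)
    ultimately have "(\<alpha>, \<beta> - j * \<alpha>) \<in> ?B"
      using z by (simp add: prim_points_def algebra_simps)
    moreover have "z = ?f (\<alpha>, \<beta> - j * \<alpha>)"
      using z by simp
    ultimately show ?thesis by blast
  next
    case True
    \<comment> \<open>The point lies in the cone between e + i * f and e + (i + 1) * f, with
      coefficients \<open>\<alpha> - s\<close> and \<open>s\<close>. It is on the edge e + i * f
      exactly when \<open>s = 0\<close>.\<close>
    define i s where "i = \<beta> div \<alpha>" and "s = \<beta> mod \<alpha>"
    have \<beta>: "\<beta> = i * \<alpha> + s" and s: "0 \<le> s" "s < \<alpha>" and i: "0 \<le> i"
      using z by (auto simp: i_def s_def pos_imp_zdiv_nonneg_iff)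
    show ?thesis
    proof (cases "s = 0")
      case True
      then have "\<alpha> = 1"
        using z(2,4) \<beta> coprime_common_divisor[of \<alpha> \<beta> \<alpha>] by simp
      then have "i = \<beta>" "\<beta> \<le> j"
        using \<beta> True \<open>\<beta> \<le> j * \<alpha>\<close> by auto
      moreover have "\<not> (2 \<le> \<beta> \<and> \<beta> \<le> j - 2)"
        using edge_product_ge[of m p r v c j \<beta>] assms z \<open>\<alpha> = 1\<close> by auto
      ultimately have "\<beta> = 1 \<or> \<beta> = j - 1 \<or> \<beta> = j"
        using z(3) by linarith
      then show ?thesis using z(1) \<open>\<alpha> = 1\<close> by auto
    next
      case False
      have "i * \<alpha> < j * \<alpha>"
        using False s True \<beta> by linarith
      then have ij: "i + 1 \<le> j"
        using s by (simp add: mult_less_cancel_right)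
      have "(i + 1) * r \<le> j * r"
        using ij assms by (intro mult_right_mono) auto
      then have v: "0 \<le> v - (i + 1) * r" "0 \<le> v - i * r"
        using assms by (auto simp: algebra_simps)
      have "c \<le> ((\<alpha> - s) * (m + i * p) + s * (m + (i + 1) * p))
              * ((\<alpha> - s) * (v - i * r) + s * (v - (i + 1) * r))"
        using assms v i s False by (intro cone_product_ge) (auto simp: algebra_simps)
      also have "\<dots> = (\<alpha> * m + \<beta> * p) * (\<alpha> * v - \<beta> * r)"
        unfolding \<beta> by (simp add: algebra_simps)
      finally show ?thesis using z by simp
    qed
  qed
qed

text \<open>The induction takes two divisions at a time: dividing \<open>v\<close> by
  \<open>r\<close> splits off at most three points, dividing \<open>r\<close> by the remainder is a
  bijection. Both shears preserve the determinant \<open>c\<close>.\<close>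

lemma card_prim_points:
  assumes "0 \<le> m" "0 \<le> p" "0 \<le> r" "0 \<le> v" "m * r + p * v = c"
  shows "finite (prim_points c m v p r) \<and>
         card (prim_points c m v p r) \<le> 3 * ((euclid_steps v r + 1) div 2)"
  using assms
proof (induction "nat r" arbitrary: m v p r rule: less_induct)
  case less
  show ?case
  proof (cases "r = 0")
    case True
    then show ?thesis
      using less.prems prim_points_zero_right[of m v p c] by simp
  next
    case False
    then have r: "0 < r" using less.prems by simp
    define j v' m' where "j = v div r" and "v' = v mod r" and "m' = m + j * p"
    have v': "v' = v - j * r" "0 \<le> v'" "v' < r" and j: "0 \<le> j" and m': "0 \<le> m'"
      using r less.prems by (auto simp: j_def v'_def m'_def minus_div_mult_eq_mod
          pos_imp_zdiv_nonneg_iff)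
    let ?A = "prim_points c m v p r" and ?B = "prim_points c m' v' p r"
    have sub: "?A \<subseteq> {(1, 1), (1, j - 1), (1, j)} \<union> (\<lambda>(\<alpha>, \<beta>). (\<alpha>, \<beta> + j * \<alpha>)) ` ?B"
      unfolding m'_def v'(1) using less.prems j v' by (intro prim_points_shear_upper) auto
    have steps: "euclid_steps v r = Suc (euclid_steps r v')"
      using r by (subst euclid_steps.simps) (simp add: v'_def)
    \<comment> \<open>Rounding down is correct because the division of \<open>r\<close> by
      \<open>v'\<close> adds no points. Three more points then turn \<open>k div 2\<close> into
      \<open>(k + 2) div 2\<close> for \<open>k = euclid_steps r v'\<close>.\<close>
    have B: "finite ?B \<and> card ?B \<le> 3 * ((euclid_steps r v') div 2)"
    proof (cases "v' = 0")
      case True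
      then show ?thesis using less.prems by (simp add: prim_points_zero_left)
    next
      case False
      then have v'_pos: "0 < v'" using v' by simp
      define j' where "j' = r div v'"
      have r': "r mod v' = r - j' * v'" and j': "0 \<le> j'"
        using v'_pos r by (auto simp: j'_def minus_div_mult_eq_mod pos_imp_zdiv_nonneg_iff)
      have r'_bounds: "0 \<le> r mod v'" "r mod v' < v'"
        using v'_pos by auto
      let ?C = "prim_points c m' v' (p + j' * m') (r mod v')"
      have "finite ?C \<and> card ?C \<le> 3 * ((euclid_steps v' (r mod v') + 1) div 2)"
      proof (rule less.hyps)
        show "nat (r mod v') < nat r" using r'_bounds v' by linarith
        show "m' * (r mod v') + (p + j' * m') * v' = c"
        proof -
          have "m' * (r mod v') + (p + j' * m') * v' = m' * r + p * v'"
            unfolding r' by (simp add: algebra_simps)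
          also have "\<dots> = m * r + p * v"
            unfolding m'_def v'(1) by (simp add: algebra_simps)
          finally show ?thesis using less.prems(5) by simp
        qed
      qed (use less.prems m' j' v' r'_bounds in auto)
      moreover have "?B = (\<lambda>(\<alpha>, \<beta>). (\<alpha> + j' * \<beta>, \<beta>)) ` ?C"
        unfolding r' using j' r' r'_bounds v' by (intro prim_points_shear_lower) auto
      moreover have "euclid_steps r v' = Suc (euclid_steps v' (r mod v'))"
        using v'_pos by (subst euclid_steps.simps) simp
      ultimately show ?thesis
        by (metis (no_types, lifting) Suc_eq_plus1 card_image_le finite_imageI order_trans)
    qed
    let ?F = "(\<lambda>(\<alpha>, \<beta>). (\<alpha>, \<beta> + j * \<alpha>)) ` ?B"
    have "finite ?F" using B by simp
    have "card ?A \<le> card ({(1, 1), (1, j - 1), (1, j)} \<union> ?F)"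
      using sub B by (intro card_mono) auto
    also have "\<dots> \<le> card {(1::int, 1::int), (1, j - 1), (1, j)} + card ?F"
      by (rule card_Un_le)
    also have "\<dots> \<le> 3 + card ?B"
      using B by (intro add_mono card_image_le) (auto simp: card_insert_if)
    also have "\<dots> \<le> 3 * ((euclid_steps v r + 1) div 2)"
      using B steps by simp
    finally show ?thesis
      using finite_subset[OF sub] \<open>finite ?F\<close> by simp
  qed
qed

section \<open>The counting function as a count of one-sided approximations\<close>

text \<open>The pairs need not be primitive: multiples of one fraction count separately, as they do
  in \<open>S\<close>.\<close>

definition approx_above :: "int \<Rightarrow> int \<Rightarrow> (int \<times> int) set" where
  "approx_above b c = {(m, l). 0 < m \<and> 0 < c * l - b * m \<and> m * (c * l - b * m) < c}"

definition approx_below :: "int \<Rightarrow> int \<Rightarrow> (int \<times> int) set" where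
  "approx_below b c = {(m, l). 0 < m \<and> 0 < b * m - c * l \<and> m * (b * m - c * l) < c}"

lemma S_eq_card_below:
  assumes "0 < c" "coprime b c"
  shows "S (of_int b / of_int c) = card (approx_below b c)"
proof -
  have q: "quotient_of (of_int b / of_int c) = (b, c)"
    using assms by (simp flip: Fract_of_int_quotient add: quotient_of_Fract)
  have "bij_betw (\<lambda>(m, l). (m, b * m - c * l)) (approx_below b c)
     {(m, n). 0 < m \<and> 0 < n \<and> m * n < c \<and> [b * m = n] (mod c)}"
    (is "bij_betw ?f ?A ?B")
  proof (rule bij_betwI')
    fix x y assume "x \<in> ?A" "y \<in> ?A"
    then show "(?f x = ?f y) = (x = y)" using assms by (auto split: prod.splits)
  next
    fix x assume "x \<in> ?A"
    then show "?f x \<in> ?B"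
      by (auto simp: approx_below_def cong_iff_dvd_diff)
  next
    fix y assume "y \<in> ?B"
    then obtain m n l where "y = (m, n)" "0 < m" "0 < n" "m * n < c" "b * m - n = c * l"
      by (auto simp: cong_iff_dvd_diff elim!: dvdE)
    then have n: "n = b * m - c * l" by linarith
    show "\<exists>x\<in>?A. y = ?f x"
      by (rule bexI[of _ "(m, l)"])
        (use \<open>y = (m, n)\<close> \<open>0 < m\<close> \<open>0 < n\<close> \<open>m * n < c\<close> n in \<open>auto simp: approx_below_def\<close>)
  qed
  then show ?thesis
    unfolding S_def q by (simp add: bij_betw_same_card)
qed

lemma S_minus_eq_card_above:
  assumes "0 < c" "coprime b c"
  shows "S (- (of_int b / of_int c)) = card (approx_above b c)"
proof -
  have "S (- (of_int b / of_int c)) = card (approx_below (- b) c)"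
    using S_eq_card_below[of c "- b"] assms by simp
  also have "approx_below (- b) c = (\<lambda>(m, l). (m, - l)) ` approx_above b c"
  proof (intro equalityI subsetI)
    fix z assume "z \<in> approx_below (- b) c"
    then have "(fst z, - snd z) \<in> approx_above b c"
      by (auto simp: approx_below_def approx_above_def algebra_simps)
    then show "z \<in> (\<lambda>(m, l). (m, - l)) ` approx_above b c"
      by (rule rev_image_eqI) simp
  qed (auto simp: approx_below_def approx_above_def algebra_simps)
  also have "card \<dots> = card (approx_above b c)"
    by (rule card_image) (auto simp: inj_on_def)
  finally show ?thesis .
qed

lemma above_pos:
  assumes "0 < b" "0 < c" "(m, l) \<in> approx_above b c"
  shows "0 < l"
proof -
  have "0 < b * m" "0 < c * l - b * m" using assms by (auto simp: approx_above_def)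
  then have "0 < c * l" by linarith
  then show ?thesis using assms by (auto simp: zero_less_mult_iff)
qed

lemma finite_above:
  assumes "0 < b" "0 < c"
  shows "finite (approx_above b c)"
proof (rule finite_subset)
  show "approx_above b c \<subseteq> {0..c} \<times> {0..c + b * c}"
  proof clarify
    fix m l assume *: "(m, l) \<in> approx_above b c"
    define w where "w = c * l - b * m"
    have w: "0 < m" "0 < w" "m * w < c" using * by (auto simp: approx_above_def w_def)
    have "m * 1 \<le> m * w" "1 * w \<le> m * w"
      using w by (intro mult_left_mono mult_right_mono; simp)+
    then have m: "m < c" "w < c" using w by linarith+
    have l: "0 < l" using above_pos[OF assms *] .
    have "1 * l \<le> c * l" using assms l by (intro mult_right_mono) auto
    also have "\<dots> = w + b * m" by (simp add: w_def)
    also have "\<dots> \<le> c + b * c" using m assms by (intro add_mono mult_left_mono) auto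
    finally show "m \<in> {0..c} \<and> l \<in> {0..c + b * c}" using m w l by simp
  qed
qed simp

section \<open>Exchange of numerator and denominator\<close>

text \<open>These are the approximations of b/c from above whose swap \<open>(l, m)\<close> fails to
  lie in \<open>approx_below c b\<close>.\<close>

definition excess :: "int \<Rightarrow> int \<Rightarrow> (int \<times> int) set" where
  "excess b c = {(m, l) \<in> approx_above b c. b \<le> l * (c * l - b * m)}"

text \<open>For w = c * l - b * m the swap maps into \<open>approx_above b c\<close> because b * m <
  c * l and l * w < b give b * m * w < c * l * w < c * b.\<close>

lemma above_eq_Un:
  assumes "0 < b" "0 < c"
  shows "approx_above b c = prod.swap ` {(l, m) \<in> approx_below c b. 0 < m} \<union> excess b c"
    (is "_ = prod.swap ` ?D \<union> _")
proof (intro equalityI subsetI)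
  fix z assume "z \<in> approx_above b c"
  then obtain m l where z: "z = (m, l)" "(m, l) \<in> approx_above b c" by (cases z) auto
  then have "0 < l" using above_pos assms by blast
  show "z \<in> prod.swap ` ?D \<union> excess b c"
  proof (cases "b \<le> l * (c * l - b * m)")
    case True
    then show ?thesis using z by (auto simp: excess_def)
  next
    case False
    then have "(l, m) \<in> ?D" using z \<open>0 < l\<close> by (auto simp: approx_below_def approx_above_def)
    then show ?thesis using z by force
  qed
next
  fix z assume "z \<in> prod.swap ` ?D \<union> excess b c"
  then show "z \<in> approx_above b c"
  proof
    assume "z \<in> prod.swap ` ?D"
    then obtain l m where z: "z = (m, l)" "0 < l" "0 < m" "0 < c * l - b * m"
        "l * (c * l - b * m) < b"
      by (auto simp: approx_below_def)
    define w where "w = c * l - b * m"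
    have w: "0 < w" "l * w < b" "b * m < c * l" using z by (auto simp: w_def)
    have "b * (m * w) = (b * m) * w" by simp
    also have "\<dots> < (c * l) * w" using w by (intro mult_strict_right_mono) auto
    also have "\<dots> = c * (l * w)" by simp
    also have "\<dots> < c * b" using w assms by (intro mult_strict_left_mono) auto
    finally have "m * w < c" using assms by (simp add: mult.commute)
    then show ?thesis using z by (auto simp: approx_above_def w_def)
  qed (auto simp: excess_def)
qed

lemma finite_below_pos:
  assumes "0 < b" "0 < c"
  shows "finite {(l, m) \<in> approx_below c b. 0 < m}"
proof (rule finite_imageD)
  show "finite (prod.swap ` {(l, m) \<in> approx_below c b. 0 < m})"
    using finite_above[OF assms] by (simp add: above_eq_Un[OF assms])
qed (auto simp: inj_on_def)

lemma card_above_eq: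
  assumes "0 < b" "0 < c"
  shows "card (approx_above b c) = card {(l, m) \<in> approx_below c b. 0 < m} + card (excess b c)"
    (is "_ = card ?D + _")
proof -
  have "prod.swap ` ?D \<inter> excess b c = {}"
    by (auto simp: excess_def approx_below_def)
  moreover have "finite (approx_above b c)" using finite_above assms by blast
  ultimately have "card (approx_above b c) = card (prod.swap ` ?D) + card (excess b c)"
    unfolding above_eq_Un[OF assms] by (intro card_Un_disjoint) auto
  moreover have "card (prod.swap ` ?D) = card ?D"
    by (rule card_image) (auto simp: inj_on_def)
  ultimately show ?thesis by simp
qed

text \<open>If \<open>d < e\<close> both scaled a primitive \<open>(m, l)\<close> into the excess set, subtracting the two
  defining inequalities would give \<open>(e\<^sup>2 - d\<^sup>2) * l * m < 1\<close>.\<close>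

lemma excess_ray_unique:
  fixes b c m l d e :: int
  assumes "0 < b" "0 < c" "0 < m" "0 < l" "0 < d"
    "(d * m, d * l) \<in> excess b c" "(e * m, e * l) \<in> excess b c"
  shows "\<not> d < e"
proof
  assume "d < e"
  define w where "w = c * l - b * m"
  have d: "c * (d * l) - b * (d * m) = d * w" and e: "c * (e * l) - b * (e * m) = e * w"
    by (auto simp: w_def algebra_simps)
  have "0 < c * (d * l) - b * (d * m)" "b \<le> d * l * (c * (d * l) - b * (d * m))"
      "e * m * (c * (e * l) - b * (e * m)) < c"
    using assms(6,7) by (auto simp: excess_def approx_above_def)
  then have h: "0 < d * w" "b \<le> (d * l) * (d * w)" "(e * m) * (e * w) < c"
    unfolding d e by auto
  then have w: "0 < w" using assms by (simp add: zero_less_mult_iff)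
  have "m * b \<le> m * ((d * l) * (d * w))" "l * ((e * m) * (e * w)) < l * c"
    using h assms by (auto intro: mult_left_mono mult_strict_left_mono)
  \<comment> \<open>The outer bounds \<open>l * c\<close> and \<open>m * b\<close> differ by exactly
    \<open>w\<close>, so \<open>w\<close> can be cancelled below.\<close>
  then have "l * m * w * (e * e - d * d) < w"
    by (simp add: w_def[symmetric] algebra_simps) (simp add: w_def algebra_simps)
  moreover have "d * d < e * e"
    using \<open>d < e\<close> assms by (intro mult_strict_mono) auto
  then have "w * 1 \<le> w * ((l * m) * (e * e - d * d))"
    using w assms by (intro mult_left_mono) (auto simp: int_one_le_iff_zero_less)
  ultimately show False by (simp add: algebra_simps)
qed

lemma div_gcd_decomposition:
  fixes m l :: int
  assumes "0 < m" "0 < l"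
  obtains g \<mu> \<nu> where "m = g * \<mu>" "l = g * \<nu>" "0 < g" "0 < \<mu>" "0 < \<nu>" "coprime \<nu> \<mu>"
    "m div gcd m l = \<mu>" "l div gcd m l = \<nu>"
proof -
  let ?g = "gcd m l"
  have g: "0 < ?g" using assms by simp
  have eq: "m = ?g * (m div ?g)" "l = ?g * (l div ?g)" by auto
  have "0 < m div ?g" "0 < l div ?g"
    using assms g by (simp_all add: pos_imp_zdiv_pos_iff zdvd_imp_le)
  moreover have "coprime (l div ?g) (m div ?g)"
    using assms div_gcd_coprime[of m l] by (simp add: coprime_commute)
  ultimately show ?thesis
    using that[OF eq g] by blast
qed

text \<open>Each excess point is sent to the primitive point on its ray, injectively by
  \<open>excess_ray_unique\<close>. In the basis (0, c), (1, -b) the coordinates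
  \<open>(l, m)\<close> describe the point (m, c * l - b * m); dividing by the gcd only shrinks the
  product.\<close>

lemma card_excess_le:
  assumes "0 < b" "0 < c"
  shows "card (excess b c) \<le> card (prim_points c 0 c 1 b)"
proof (rule card_inj_on_le)
  let ?f = "\<lambda>(m, l). (l div gcd m l, m div gcd m l)"
  have pos: "0 < m" "0 < l" if "(m, l) \<in> excess b c" for m l
  proof -
    have ml: "(m, l) \<in> approx_above b c"
      using that by (simp add: excess_def)
    then show "0 < m" by (simp add: approx_above_def)
    show "0 < l" by (rule above_pos[OF assms ml])
  qed
  show "inj_on ?f (excess b c)"
  proof (rule inj_onI, clarify)
    fix m l m' l'
    assume 1: "(m, l) \<in> excess b c" and 2: "(m', l') \<in> excess b c"
      and eq: "l div gcd m l = l' div gcd m' l'" "m div gcd m l = m' div gcd m' l'"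
    obtain g \<mu> \<nu> where a: "m = g * \<mu>" "l = g * \<nu>" "0 < g" "0 < \<mu>" "0 < \<nu>"
        "m div gcd m l = \<mu>" "l div gcd m l = \<nu>"
      by (rule div_gcd_decomposition[OF pos[OF 1]])
    obtain g' \<mu>' \<nu>' where b: "m' = g' * \<mu>'" "l' = g' * \<nu>'" "0 < g'"
        "m' div gcd m' l' = \<mu>'" "l' div gcd m' l' = \<nu>'"
      by (rule div_gcd_decomposition[OF pos[OF 2]])
    have same: "\<mu>' = \<mu>" "\<nu>' = \<nu>" using a(6,7) b(4,5) eq by simp_all
    have "(g * \<mu>, g * \<nu>) \<in> excess b c" "(g' * \<mu>, g' * \<nu>) \<in> excess b c"
      using 1 2 a(1,2) b(1,2) same by simp_all
    then have "\<not> g < g'" "\<not> g' < g"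
      using excess_ray_unique[OF assms a(4,5)] a(3) b(3) by blast+
    then show "m = m' \<and> l = l'" using a(1,2) b(1,2) same by simp
  qed
  show "?f ` excess b c \<subseteq> prim_points c 0 c 1 b"
  proof
    fix z assume "z \<in> ?f ` excess b c"
    then obtain m l where ml: "(m, l) \<in> excess b c" "z = ?f (m, l)" by auto
    obtain g \<mu> \<nu> where a: "m = g * \<mu>" "l = g * \<nu>" "0 < g" "0 < \<mu>" "0 < \<nu>" "coprime \<nu> \<mu>"
        "m div gcd m l = \<mu>" "l div gcd m l = \<nu>"
      by (rule div_gcd_decomposition[OF pos[OF ml(1)]])
    define w where "w = \<nu> * c - \<mu> * b"
    have "c * l - b * m = g * w" by (simp add: a w_def algebra_simps)
    moreover have "0 < c * l - b * m" "m * (c * l - b * m) < c"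
      using ml(1) by (simp_all add: excess_def approx_above_def)
    ultimately have w: "0 < g * w" "(g * \<mu>) * (g * w) < c"
      by (simp_all only: a(1))
    have "0 < w" using w a by (simp add: zero_less_mult_iff)
    have "1 * 1 \<le> g * g" using a by (intro mult_mono) auto
    then have "1 * (\<mu> * w) \<le> (g * g) * (\<mu> * w)"
      using a \<open>0 < w\<close> by (intro mult_right_mono) auto
    then have "\<mu> * w < c" using w by (simp add: algebra_simps)
    then show "z \<in> prim_points c 0 c 1 b"
      using ml(2) a(4-) \<open>0 < w\<close> by (simp add: prim_points_def w_def)
  qed
  show "finite (prim_points c 0 c 1 b)"
    using card_prim_points[of 0 1 b c c] assms by simp
qed

text \<open>Here the first division, of \<open>c\<close> by \<open>b\<close>, is one that costs
  points, so an odd number of steps is rounded up; this is the source of the additive 3.\<close>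

lemma card_excess_lt:
  assumes "0 < b" "b < c"
  shows "2 * card (excess b c) \<le> 3 * euclid_steps c b + 3"
proof -
  have "card (excess b c) \<le> 3 * ((euclid_steps c b + 1) div 2)"
    using card_excess_le[of b c] card_prim_points[of 0 1 b c c] assms by (auto intro: order_trans)
  moreover have "2 * ((euclid_steps c b + 1) div 2) \<le> euclid_steps c b + 1"
    by simp
  ultimately show ?thesis by linarith
qed

text \<open>For \<open>c < b\<close> the first division is a free lower shear. Only the steps after
  it are charged, which removes the additive 3.\<close>

lemma card_excess_gt:
  assumes "0 < c" "c < b"
  shows "2 * card (excess b c) \<le> 3 * euclid_steps b c"
proof -
  let ?j = "b div c" and ?C = "prim_points c 0 c 1 (b mod c)"
  have j: "0 \<le> ?j" "b - ?j * c = b mod c" "0 \<le> b mod c"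
    using assms by (auto simp: pos_imp_zdiv_nonneg_iff minus_div_mult_eq_mod)
  then have "?j * c \<le> b" by linarith
  have "prim_points c 0 c 1 b = (\<lambda>(\<alpha>, \<beta>). (\<alpha> + ?j * \<beta>, \<beta>)) ` prim_points c 0 c (1 + ?j * 0) (b - ?j * c)"
    using j \<open>?j * c \<le> b\<close> assms by (intro prim_points_shear_lower) auto
  then have eq: "prim_points c 0 c 1 b = (\<lambda>(\<alpha>, \<beta>). (\<alpha> + ?j * \<beta>, \<beta>)) ` ?C"
    using j by simp
  have C: "finite ?C \<and> card ?C \<le> 3 * ((euclid_steps c (b mod c) + 1) div 2)"
    using card_prim_points[of 0 1 "b mod c" c c] j assms by simp
  have "card (excess b c) \<le> card (prim_points c 0 c 1 b)"
    using card_excess_le assms by simp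
  also have "\<dots> \<le> card ?C" unfolding eq using C by (simp add: card_image_le)
  finally have "card (excess b c) \<le> 3 * ((euclid_steps c (b mod c) + 1) div 2)" using C by simp
  moreover have "euclid_steps b c = Suc (euclid_steps c (b mod c))"
    using assms by (subst euclid_steps.simps) simp
  ultimately show ?thesis by simp
qed

section \<open>The square-root term\<close>

text \<open>A negative \<open>m\<close> would make \<open>c * l - b * m\<close> at least
  \<open>b\<close>, and multiplying by \<open>l \<ge> 1\<close> keeps it there.\<close>

lemma below_nonpos:
  assumes "0 < b" "0 < c" "(l, m) \<in> approx_below c b" "m \<le> 0"
  shows "m = 0"
proof (rule ccontr)
  assume "m \<noteq> 0"
  then have "b * 1 \<le> b * (- m)" using assms by (intro mult_left_mono) auto
  moreover have "0 < c * l" "0 < l" "l * (c * l - b * m) < b" using assms by (auto simp: approx_below_def)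
  moreover from calculation have "b \<le> c * l - b * m" by linarith
  ultimately have "1 * b \<le> l * (c * l - b * m)"
    using assms by (intro mult_mono) auto
  then show False using \<open>l * (c * l - b * m) < b\<close> by simp
qed

text \<open>Because the inequality is strict, the count is the ceiling of \<open>s\<close> minus 1,
  which is at least \<open>s - 1\<close> also for integral \<open>s\<close>.\<close>

lemma card_squares_below:
  fixes s :: real
  assumes "1 < s"
  defines "N \<equiv> {l :: int. 0 < l \<and> real_of_int l < s}"
  shows "finite N \<and> s - 1 \<le> real (card N) \<and> real (card N) \<le> s"
proof -
  have "N = {1..\<lceil>s\<rceil> - 1}"
    unfolding N_def by (auto simp flip: less_ceiling_iff)
  moreover from this have "card N = nat (\<lceil>s\<rceil> - 1)" by simp
  moreover have "1 \<le> \<lceil>s\<rceil>" using assms by linarith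
  ultimately show ?thesis by simp
qed

text \<open>By \<open>below_nonpos\<close> the pairs without \<open>0 < m\<close> have
  \<open>m = 0\<close>, where the condition reduces to \<open>c * l * l < b\<close>.\<close>

lemma card_below_split:
  assumes "0 < b" "0 < c"
  shows "real (card (approx_below c b))
       = real (card {(l, m) \<in> approx_below c b. 0 < m}) + real (card {l :: int. 0 < l \<and> c * l * l < b})"
    (is "_ = real (card ?D) + real (card ?N)")
proof -
  have eq: "approx_below c b = ?D \<union> (\<lambda>l. (l, 0)) ` ?N"
    using below_nonpos[OF assms] assms
    by (fastforce simp: approx_below_def image_iff mult_ac)
  have fN: "finite ?N"
  proof (rule finite_subset)
    show "?N \<subseteq> {0..b}"
    proof clarify
      fix l assume l: "0 < l" "c * l * l < b"
      have "1 * 1 \<le> c * l" using l assms by (intro mult_mono) auto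
      then have "1 * l \<le> c * l * l" using l by (intro mult_right_mono) auto
      then have "l \<le> b" using l by linarith
      then show "l \<in> {0..b}" using l by simp
    qed
  qed simp
  have "card (approx_below c b) = card ?D + card ((\<lambda>l. (l, 0 :: int)) ` ?N)"
    by (subst eq, rule card_Un_disjoint) (use finite_below_pos[OF assms] fN in auto)
  also have "card ((\<lambda>l. (l, 0 :: int)) ` ?N) = card ?N"
    by (rule card_image) (auto simp: inj_on_def)
  finally show ?thesis by simp
qed

section \<open>Logarithmic length of Euclid's algorithm\<close>

text \<open>The product of the current pair at least halves at every division with nonzero remainder
  r, since b >= c + r > 2 * r. The last division gives only \<open>b * c \<ge> 1\<close>, hence the
  exponent is one less than the number of steps.\<close>

lemma euclid_steps_two_power_le:
  assumes "0 < c" "c \<le> b"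
  shows "2 ^ (euclid_steps b c - 1) \<le> b * c"
  using assms
proof (induction "nat c" arbitrary: b c rule: less_induct)
  case less
  let ?r = "b mod c"
  have steps: "euclid_steps b c = Suc (euclid_steps c ?r)"
    using less.prems by (subst euclid_steps.simps) simp
  have r: "0 \<le> ?r" "?r < c" using less.prems by auto
  show ?case
  proof (cases "?r = 0")
    case True
    have "1 * 1 \<le> b * c" using less.prems by (intro mult_mono) auto
    then show ?thesis
      using True steps by (simp add: euclid_steps.simps[of c 0])
  next
    case False
    then have "0 < euclid_steps c ?r" using r by (subst euclid_steps.simps) auto
    then have "(2 :: int) ^ (euclid_steps b c - 1) = 2 * 2 ^ (euclid_steps c ?r - 1)"
      using steps by (simp flip: power_Suc)
    also have "\<dots> \<le> 2 * (c * ?r)"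
      using less.hyps[of ?r c] r False by simp
    also have "\<dots> = (2 * ?r) * c" by simp
    also have "\<dots> \<le> b * c"
    proof (rule mult_right_mono)
      have "1 * c \<le> (b div c) * c"
        using less.prems by (intro mult_right_mono) (auto simp: pos_imp_zdiv_pos_iff int_one_le_iff_zero_less)
      then show "2 * ?r \<le> b"
        using r div_mult_mod_eq[of b c] by linarith
    qed (use less.prems in simp)
    finally show ?thesis .
  qed
qed

lemma euclid_steps_ln_le:
  assumes "0 < c" "c < b"
  shows "3 / 2 * real (euclid_steps b c) + 3 \<le> (9 / 2 + 3 / ln 2) * ln (2 + real_of_int b)"
proof -
  let ?k = "euclid_steps b c" and ?L = "ln (2 + real_of_int b)"
  have "2 ^ (?k - 1) \<le> b * c" using assms by (intro euclid_steps_two_power_le) auto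
  also have "\<dots> \<le> b * b" using assms by (intro mult_left_mono) auto
  finally have "real_of_int (2 ^ (?k - 1)) \<le> real_of_int (b * b)"
    by (simp only: of_int_le_iff)
  then have "ln ((2 :: real) ^ (?k - 1)) \<le> ln (real_of_int b * real_of_int b)"
    using assms by (subst ln_le_cancel_iff) auto
  then have "real (?k - 1) * ln 2 \<le> 2 * ln (real_of_int b)"
    using assms by (simp add: ln_realpow ln_mult)
  also have "\<dots> \<le> 2 * ?L" using assms by simp
  finally have "real (?k - 1) \<le> 2 * ?L / ln 2" by (simp add: field_simps)
  moreover have "real ?k \<le> real (?k - 1) + 1" by simp
  ultimately have "3 / 2 * real ?k + 3 \<le> 3 / 2 * (2 * ?L / ln 2 + 1) + 3" by simp
  also have "\<dots> = 3 / ln 2 * ?L + 9 / 2" by (simp add: field_simps)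
  also have "\<dots> \<le> 3 / ln 2 * ?L + 9 / 2 * ?L"
  proof -
    \<comment> \<open>The shift by 2 makes the logarithm at least 1, so that the constant 9/2 can be
      absorbed into it.\<close>
    have "exp 1 \<le> 2 + real_of_int b" using exp_le assms by linarith
    then have "1 \<le> ?L" using assms by (subst ln_ge_iff) auto
    then show ?thesis by simp
  qed
  finally show ?thesis by (simp add: algebra_simps)
qed

section \<open>Bounds for the two error terms\<close>

text \<open>The approximations matched by the swap cancel. What remains is the number of
  \<open>l\<close> with \<open>a * l * l < q\<close>, within 1 of the square root, minus
  \<open>card (excess q a)\<close>.\<close>

lemma E_plus_bound:
  fixes a q :: int
  assumes "1 \<le> a" "a < q" "coprime a q"
  shows "\<bar>real (S (of_int a / of_int q)) - real (S (- (of_int q / of_int a)))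
           - sqrt (real_of_int q / real_of_int a)\<bar> \<le> 3 / 2 * real (euclid_steps q a) + 3"
proof -
  let ?s = "sqrt (real_of_int q / real_of_int a)"
  have "{l :: int. 0 < l \<and> a * l * l < q} = {l :: int. 0 < l \<and> real_of_int l < ?s}"
  proof (intro Collect_cong conj_cong refl)
    fix l :: int assume l: "0 < l"
    have "real_of_int l < ?s \<longleftrightarrow> (real_of_int l)\<^sup>2 < real_of_int q / real_of_int a"
      using l by (metis abs_of_nonneg less_eq_real_def of_int_0_less_iff real_sqrt_abs real_sqrt_less_iff)
    also have "\<dots> \<longleftrightarrow> real_of_int (a * l * l) < real_of_int q"
      using assms by (simp add: field_simps power2_eq_square)
    finally show "(a * l * l < q) = (real_of_int l < ?s)" by linarith
  qed
  moreover have "1 < ?s" using assms by simp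
  ultimately have N: "?s - 1 \<le> real (card {l :: int. 0 < l \<and> a * l * l < q})"
      "real (card {l :: int. 0 < l \<and> a * l * l < q}) \<le> ?s"
    using card_squares_below[of ?s] by auto
  have "S (of_int a / of_int q) = card (approx_below a q)" "S (- (of_int q / of_int a)) = card (approx_above q a)"
    using assms by (simp_all add: S_eq_card_below S_minus_eq_card_above coprime_commute)
  then have "real (S (of_int a / of_int q)) - real (S (- (of_int q / of_int a)))
      = real (card {l :: int. 0 < l \<and> a * l * l < q}) - real (card (excess q a))"
    using card_below_split[of q a] card_above_eq[of q a] assms by simp
  moreover have "2 * real (card (excess q a)) \<le> 3 * real (euclid_steps q a)"
    using card_excess_gt[of a q] assms by linarith
  ultimately show ?thesis using N by linarith
qed

text \<open>With the roles of \<open>a\<close> and \<open>q\<close> exchanged no \<open>l\<close>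
  satisfies \<open>q * l * l < a\<close>, so the difference is exactly
  \<open>card (excess a q)\<close>.\<close>

lemma E_minus_bound:
  fixes a q :: int
  assumes "1 \<le> a" "a < q" "coprime a q"
  shows "\<bar>real (S (- (of_int a / of_int q))) - real (S (of_int q / of_int a))\<bar>
           \<le> 3 / 2 * real (euclid_steps q a) + 3"
proof -
  have "a \<le> q * l * l" if "0 < l" for l
  proof -
    have "q * 1 \<le> q * (l * l)"
      using assms that by (intro mult_left_mono) (auto simp: int_one_le_iff_zero_less)
    then have "q \<le> q * l * l" by (simp add: mult.assoc)
    then show ?thesis using assms by linarith
  qed
  then have "{l :: int. 0 < l \<and> q * l * l < a} = {}" by force
  then have "card {l :: int. 0 < l \<and> q * l * l < a} = 0" by (simp only: card.empty)
  moreover have "S (- (of_int a / of_int q)) = card (approx_above a q)"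
      "S (of_int q / of_int a) = card (approx_below q a)"
    using assms by (simp_all add: S_eq_card_below S_minus_eq_card_above coprime_commute)
  ultimately have "real (S (- (of_int a / of_int q))) - real (S (of_int q / of_int a))
      = real (card (excess a q))"
    using card_below_split[of a q] card_above_eq[of a q] assms by simp
  moreover have "2 * real (card (excess a q)) \<le> 3 * real (euclid_steps q a) + 3"
    using card_excess_lt[of a q] assms by linarith
  ultimately show ?thesis by linarith
qed

theorem theorem1:
  shows "\<exists>E_plus E_minus :: int \<Rightarrow> int \<Rightarrow> real.
    (\<forall>a q :: int. 1 \<le> a \<and> a < q \<and> coprime a q \<longrightarrow>
       real (S (of_int a / of_int q)) - real (S (- (of_int q / of_int a)))
         = sqrt (real_of_int q / real_of_int a) + E_plus a q \<and>
       real (S (- (of_int a / of_int q))) - real (S (of_int q / of_int a))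
         = E_minus a q \<and>
       \<bar>E_plus a q\<bar> \<le> 3 / 2 * real (euclid_steps q a) + 3 \<and>
       \<bar>E_minus a q\<bar> \<le> 3 / 2 * real (euclid_steps q a) + 3) \<and>
    (\<exists>C :: real. \<forall>a q :: int. 1 \<le> a \<and> a < q \<and> coprime a q \<longrightarrow>
       \<bar>E_plus a q\<bar> \<le> C * ln (2 + real_of_int q) \<and>
       \<bar>E_minus a q\<bar> \<le> C * ln (2 + real_of_int q))"
proof (intro exI conjI allI impI)
  \<comment> \<open>The error terms are the differences themselves, so both identities are immediate
    and only the bounds have content.\<close>
  let ?P = "\<lambda>a q. real (S (of_int a / of_int q)) - real (S (- (of_int q / of_int a)))
           - sqrt (real_of_int q / real_of_int a)"
  let ?M = "\<lambda>a q. real (S (- (of_int a / of_int q))) - real (S (of_int q / of_int a))"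
  fix a q :: int
  assume *: "1 \<le> a \<and> a < q \<and> coprime a q"
  show "real (S (of_int a / of_int q)) - real (S (- (of_int q / of_int a)))
      = sqrt (real_of_int q / real_of_int a) + ?P a q" by simp
  show "?M a q = ?M a q" ..
  show P: "\<bar>?P a q\<bar> \<le> 3 / 2 * real (euclid_steps q a) + 3"
    using E_plus_bound * by blast
  show M: "\<bar>?M a q\<bar> \<le> 3 / 2 * real (euclid_steps q a) + 3"
    using E_minus_bound * by blast
  have "3 / 2 * real (euclid_steps q a) + 3 \<le> (9 / 2 + 3 / ln 2) * ln (2 + real_of_int q)"
    using * by (intro euclid_steps_ln_le) auto
  then show "\<bar>?P a q\<bar> \<le> (9 / 2 + 3 / ln 2) * ln (2 + real_of_int q)"
      "\<bar>?M a q\<bar> \<le> (9 / 2 + 3 / ln 2) * ln (2 + real_of_int q)"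
    using P M by linarith+
qed

end
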